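(* For every $n\ge1$, $L(n,2)=SPM(n)\unlhd L_B(n)\unlhd L(n,1)$, where $\unlhd$ denotes the suborder relation.
   Context: A composition of $n$ is a sequence $a=(a_1,\ldots,a_n)$ of nonnegative integers with $\sum a_i=n$; it is a partition of $n$ if moreover $a_1\ge\cdots\ge a_n$. For an integer $\theta$, a transition $T(\theta)$ transforms a composition $a$ into the composition $(a_1,\ldots,a_i-1,a_{i+1}+1,\ldots,a_n)$ for some $1\le i\le n-1$ with $a_i-a_{i+1}\ge\theta$ (and $a_i\ge1$, so that the result is a composition). $L(n,\theta)$ is the set of all compositions obtained from $N=(n,0,\ldots,0)$ by iterating $T(\theta)$, ordered by: $a\ge_\theta b$ iff $b$ is obtained from $a$ by a (possibly empty) finite sequence of transitions $T(\theta)$. $SPM(n)$ is the set of partitions of $n$ obtained from $N$ by iterating the $SPM$ rule, which transforms a partition $a$ into $(a_1,\ldots,a_i-1,a_{i+1}+1,\ldots,a_n)$ for some $1\le i\le n-1$ with $a_i-a_{i+1}\ge2$; it is ordered by: $a\ge_{SPM}b$ iff $b$ is obtained from $a$ by a finite sequence of applications of this rule. $L_B(n)$ is the set of all partitions of $n$ with the dominance ordering: $a\le_B b$ iff $\sum_{j=1}^i a_j\le\sum_{j=1}^i b_j$ for all $1\le i\le n$. For ordered sets, $X\unlhd Y$ means that $X\subseteq Y$ and the order of $X$ is the restriction of the order of $Y$. *)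

theory Defs
  imports Main
begin

text \<open>
  A sequence \<open>(a\<^sub>1, \<dots>, a\<^sub>n)\<close> is a list of length \<open>n\<close> whose 0-based entry \<open>a ! i\<close> is \<open>a\<^sub>i\<^sub>+\<^sub>1\<close>.
\<close>

definition composition :: "nat \<Rightarrow> nat list \<Rightarrow> bool" where
  "composition n a \<longleftrightarrow> length a = n \<and> sum_list a = n"

definition int_partition :: "nat \<Rightarrow> nat list \<Rightarrow> bool" where
  "int_partition n a \<longleftrightarrow> composition n a \<and> sorted_wrt (\<ge>) a"

definition move_grain :: "nat \<Rightarrow> nat list \<Rightarrow> nat list" where
  "move_grain i a = a[i := a ! i - 1, Suc i := a ! Suc i + 1]"

definition transition :: "nat \<Rightarrow> int \<Rightarrow> nat list \<Rightarrow> nat list \<Rightarrow> bool" where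
  "transition n \<theta> a b \<longleftrightarrow> composition n a \<and>
     (\<exists>i. Suc i < n \<and> a ! i \<ge> 1 \<and> int (a ! i) - int (a ! Suc i) \<ge> \<theta> \<and> b = move_grain i a)"

definition spm_rule :: "nat \<Rightarrow> nat list \<Rightarrow> nat list \<Rightarrow> bool" where
  "spm_rule n a b \<longleftrightarrow> int_partition n a \<and>
     (\<exists>i. Suc i < n \<and> int (a ! i) - int (a ! Suc i) \<ge> 2 \<and> b = move_grain i a)"

definition start :: "nat \<Rightarrow> nat list" where
  "start n = n # replicate (n - 1) 0"

text \<open>
  An ordered set is a pair of a carrier and a relation on that carrier; the pair \<open>(b, a)\<close>
  belongs to the relation iff \<open>b \<le> a\<close>.
\<close>

type_synonym 'a ordered_set = "'a set \<times> ('a \<times> 'a) set"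

definition suborder :: "'a ordered_set \<Rightarrow> 'a ordered_set \<Rightarrow> bool" (infix "\<unlhd>" 50) where
  "X \<unlhd> Y \<longleftrightarrow> fst X \<subseteq> fst Y \<and> snd X = snd Y \<inter> (fst X \<times> fst X)"

definition L_set :: "nat \<Rightarrow> int \<Rightarrow> nat list set" where
  "L_set n \<theta> = {a. composition n a \<and> (transition n \<theta>)\<^sup>*\<^sup>* (start n) a}"

definition L :: "nat \<Rightarrow> int \<Rightarrow> nat list ordered_set" where
  "L n \<theta> = (L_set n \<theta>, {(b, a). b \<in> L_set n \<theta> \<and> a \<in> L_set n \<theta> \<and> (transition n \<theta>)\<^sup>*\<^sup>* a b})"

definition SPM_set :: "nat \<Rightarrow> nat list set" where
  "SPM_set n = {a. int_partition n a \<and> (spm_rule n)\<^sup>*\<^sup>* (start n) a}"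

definition SPM :: "nat \<Rightarrow> nat list ordered_set" where
  "SPM n = (SPM_set n, {(b, a). b \<in> SPM_set n \<and> a \<in> SPM_set n \<and> (spm_rule n)\<^sup>*\<^sup>* a b})"

definition dominated :: "nat \<Rightarrow> nat list \<Rightarrow> nat list \<Rightarrow> bool" where
  "dominated n a b \<longleftrightarrow> (\<forall>i\<in>{1..n}. (\<Sum>j<i. a ! j) \<le> (\<Sum>j<i. b ! j))"

definition L_B :: "nat \<Rightarrow> nat list ordered_set" where
  "L_B n = ({a. int_partition n a},
            {(a, b). int_partition n a \<and> int_partition n b \<and> dominated n a b})"

end

theory Submission
  imports Defs
begin

text \<open>
  A transition at \<open>i\<close> lowers exactly one prefix sum, the one ending at \<open>i\<close>, so reachability implies
  dominance. Conversely, let \<open>b\<close> be dominated by \<open>a \<noteq> b\<close>, and take a maximal block of positions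
  where the prefix sum of \<open>a\<close> exceeds that of \<open>b\<close>. On entering the block at \<open>l\<close> we have
  \<open>a\<^sub>l > b\<^sub>l\<close>, on leaving it at \<open>p\<close> we have \<open>a\<^sub>p < b\<^sub>p\<close>, so \<open>a\<close> falls from \<open>l\<close> to \<open>p\<close> by at least
  \<open>b\<^sub>l - b\<^sub>p + 2\<close>. If \<open>b\<^sub>l - b\<^sub>p \<ge> (\<theta> - 1) (p - l) - 1\<close>, then some step of \<open>a\<close> inside the block is at
  least \<open>\<theta>\<close>, and the transition there stays above \<open>b\<close>. For \<open>\<theta> = 1\<close> this condition holds for
  every partition \<open>b\<close>; for \<open>\<theta> = 2\<close> it is an invariant of the SPM rule.
\<close>

section \<open>Prefix sums and dominance under a transition\<close>

lemma length_move_grain [simp]: "length (move_grain i a) = length a"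
  by (simp add: move_grain_def)

lemma nth_move_grain:
  assumes "Suc i < length a"
  shows "move_grain i a ! j =
    (if j = Suc i then a ! j + 1 else if j = i then a ! j - 1 else a ! j)"
  using assms by (simp add: move_grain_def nth_list_update)

text \<open>The grain crosses only the boundary between positions \<open>i\<close> and
  \<open>Suc i\<close>. The loss is added on the left so that no truncated subtraction
  occurs.\<close>

lemma sum_prefix_move_grain:
  assumes "Suc i < length a" "a ! i \<ge> 1"
  shows "(\<Sum>j<k. move_grain i a ! j) + of_bool (k = Suc i) = (\<Sum>j<k. a ! j)"
proof (induction k)
  case 0
  show ?case by simp
next
  case (Suc k)
  then show ?case using assms by (auto simp: nth_move_grain split: if_splits)
qed

lemma sum_list_conv_prefix: "sum_list a = (\<Sum>j<length a. a ! j)"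
  by (simp add: sum_list_sum_nth atLeast0LessThan)

lemma composition_move_grain:
  assumes "composition n a" "Suc i < n" "a ! i \<ge> 1"
  shows "composition n (move_grain i a)"
  using sum_prefix_move_grain[of i a n] assms
  by (auto simp: composition_def sum_list_conv_prefix)

lemma dominated_alt: "dominated n a b \<longleftrightarrow> (\<forall>i\<le>n. (\<Sum>j<i. a ! j) \<le> (\<Sum>j<i. b ! j))"
proof -
  have "(\<Sum>j<i. a ! j) \<le> (\<Sum>j<i. b ! j)" if "dominated n a b" "i \<le> n" for i
    using that by (cases "i = 0") (auto simp: dominated_def)
  then show ?thesis by (auto simp: dominated_def)
qed

lemma transition_dominated:
  assumes "transition n \<theta> a b"
  shows "dominated n b a"
proof -
  obtain i where "Suc i < length a" "a ! i \<ge> 1" "b = move_grain i a"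
    using assms by (auto simp: transition_def composition_def)
  then show ?thesis
    unfolding dominated_def by (metis sum_prefix_move_grain le_add1)
qed

lemma rtranclp_transition_dominated:
  assumes "(transition n \<theta>)\<^sup>*\<^sup>* a b"
  shows "dominated n b a"
  using assms
proof (induction rule: rtranclp_induct)
  case base
  show ?case by (simp add: dominated_def)
next
  case (step b c)
  then show ?case using transition_dominated[OF step(2)] unfolding dominated_def by fastforce
qed

section \<open>From dominance to reachability\<close>

lemma exists_dominating_transition:
  assumes a: "composition n a" and b: "composition n b"
    and dom: "dominated n b a" and neq: "a \<noteq> b" and "\<theta> \<ge> 1"
    and slope: "\<And>i j. i < j \<Longrightarrow> j < n \<Longrightarrow> b ! j > 0 \<Longrightarrow>
      int (b ! i) - int (b ! j) \<ge> (\<theta> - 1) * (int j - int i) - 1"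
  shows "\<exists>a'. transition n \<theta> a a' \<and> dominated n b a'"
proof -
  let ?S = "\<lambda>c i. \<Sum>j<i. c ! j :: nat"
  let ?ex = "\<lambda>i. ?S b (Suc i) < ?S a (Suc i)"
  have le: "?S b i \<le> ?S a i" if "i \<le> n" for i
    using dom that by (simp add: dominated_alt)
  have len: "length a = n" "length b = n" and total: "?S a n = n" "?S b n = n"
    using a b sum_list_conv_prefix[of a] sum_list_conv_prefix[of b] by (auto simp: composition_def)
  \<comment> \<open>Otherwise all prefix sums agree, and consecutive differences give
    \<open>a = b\<close>.\<close>
  have "\<exists>i<n. ?ex i"
  proof (rule ccontr)
    assume *: "\<not> ?thesis"
    have eq: "?S a i = ?S b i" if "i \<le> n" for i
    proof (cases i)
      case (Suc k)
      then have "\<not> ?ex k" using * that by auto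
      with le[OF that] Suc show ?thesis by (simp only: not_less antisym)
    qed simp
    have "a ! i = b ! i" if "i < n" for i
      using eq[of i] eq[of "Suc i"] that by simp
    with len neq show False by (metis nth_equalityI)
  qed
  then obtain i0 where i0: "i0 < n" "?ex i0" by blast
  define l where "l = (LEAST i. ?ex i)"
  have l: "?ex l" "l \<le> i0" and l_min: "\<And>i. i < l \<Longrightarrow> \<not> ?ex i"
    unfolding l_def using i0 by (auto intro: LeastI Least_le dest: not_less_Least)
  have "l < n" using l i0 by simp
  \<comment> \<open>By minimality of \<open>l\<close> the excess is created at \<open>l\<close>
    itself; for \<open>l = 0\<close> both prefixes are empty.\<close>
  have "?S a l = ?S b l"
    using l_min[of "l - 1"] le[of l] \<open>l < n\<close> by (cases l) (auto simp: not_less)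
  with l have enter: "b ! l < a ! l" by simp
  define p where "p = (LEAST i. l < i \<and> \<not> ?ex i)"
  \<comment> \<open>Both totals are \<open>n\<close>, so the block ends at the last position at the
    latest; this makes \<open>p\<close> well defined.\<close>
  have "\<not> ?ex (n - 1)" using total \<open>l < n\<close> by (cases n) auto
  moreover have "l \<noteq> n - 1" using calculation l by metis
  ultimately have last: "l < n - 1 \<and> \<not> ?ex (n - 1)" using \<open>l < n\<close> by linarith
  have p: "l < p \<and> \<not> ?ex p" unfolding p_def using last by (rule LeastI)
  have "p \<le> n - 1" unfolding p_def using last by (rule Least_le)
  then have "p < n" using last by linarith
  have block: "?ex i" if "l \<le> i" "i < p" for i
    using not_less_Least[of i "\<lambda>i. l < i \<and> \<not> ?ex i"] that l(1)
    unfolding p_def[symmetric] by (cases "i = l") auto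
  have "?S b p < ?S a p" using block[of "p - 1"] p by (cases p) auto
  with p have leave: "a ! p < b ! p" by simp
  have "\<exists>i. l \<le> i \<and> i < p \<and> int (a ! i) - int (a ! Suc i) \<ge> \<theta>"
  proof (rule ccontr)
    assume *: "\<not> ?thesis"
    \<comment> \<open>Telescoping: each integer step below \<open>\<theta>\<close> is at most
      \<open>\<theta> - 1\<close>.\<close>
    have "int (a ! l) - int (a ! k) \<le> (\<theta> - 1) * (int k - int l)" if "l \<le> k" "k \<le> p" for k
      using that
    proof (induction k rule: dec_induct)
      case base
      show ?case by simp
    next
      case (step k)
      have "\<not> int (a ! k) - int (a ! Suc k) \<ge> \<theta>" using * step by auto
      with step show ?case by (simp add: algebra_simps)
    qed
    from this[of p] have "int (a ! l) - int (a ! p) \<le> (\<theta> - 1) * (int p - int l)" using p by simp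
    \<comment> \<open>\<open>slope\<close> applies because \<open>leave\<close> forces
      \<open>b ! p > 0\<close>.\<close>
    moreover have "int (b ! l) - int (b ! p) \<ge> (\<theta> - 1) * (int p - int l) - 1"
      using slope[of l p] p \<open>p < n\<close> leave by simp
    ultimately show False using enter leave by linarith
  qed
  then obtain i where i: "l \<le> i" "i < p" "int (a ! i) - int (a ! Suc i) \<ge> \<theta>" by blast
  then have pos: "a ! i \<ge> 1" "Suc i < n" using \<open>\<theta> \<ge> 1\<close> \<open>p < n\<close> by linarith+
  \<comment> \<open>The only prefix sum that drops loses 1, and inside the block the excess there is
    at least 1.\<close>
  have "?S b k \<le> ?S (move_grain i a) k" if "k \<le> n" for k
    using sum_prefix_move_grain[of i a k] le[OF that] block[OF i(1,2)] pos len
    by (cases "k = Suc i") auto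
  then have "dominated n b (move_grain i a)" by (simp add: dominated_alt)
  moreover have "transition n \<theta> a (move_grain i a)"
    using a i pos by (auto simp: transition_def)
  ultimately show ?thesis by blast
qed

text \<open>Termination measure: the prefix that drops has length \<open>Suc i < n\<close>, so it
  occurs in the outer sum.\<close>

lemma transition_sum_prefixes_less:
  assumes "transition n \<theta> a b"
  shows "(\<Sum>k<n. \<Sum>j<k. b ! j) < (\<Sum>k<n. \<Sum>j<k. a ! j)"
proof -
  obtain i where i: "Suc i < n" "Suc i < length a" "a ! i \<ge> 1" "b = move_grain i a"
    using assms by (auto simp: transition_def composition_def)
  then have S: "(\<Sum>j<k. b ! j) + of_bool (k = Suc i) = (\<Sum>j<k. a ! j)" for k
    using sum_prefix_move_grain by simp
  show ?thesis
  proof (rule sum_strict_mono_ex1)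
    show "\<forall>k\<in>{..<n}. (\<Sum>j<k. b ! j) \<le> (\<Sum>j<k. a ! j)" using S by (metis le_add1)
    show "\<exists>k\<in>{..<n}. (\<Sum>j<k. b ! j) < (\<Sum>j<k. a ! j)"
      using S[of "Suc i"] i(1) by (intro bexI[of _ "Suc i"]) auto
  qed simp
qed

text \<open>The slope condition concerns only the target \<open>b\<close>, so it survives every step
  down from \<open>a\<close>.\<close>

lemma dominated_imp_rtranclp_transition:
  assumes "composition n a" "composition n b" "dominated n b a" "\<theta> \<ge> 1"
    and "\<And>i j. i < j \<Longrightarrow> j < n \<Longrightarrow> b ! j > 0 \<Longrightarrow>
      int (b ! i) - int (b ! j) \<ge> (\<theta> - 1) * (int j - int i) - 1"
  shows "(transition n \<theta>)\<^sup>*\<^sup>* a b"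
  using assms(1,3)
proof (induction "\<Sum>k<n. \<Sum>j<k. a ! j" arbitrary: a rule: less_induct)
  case less
  show ?case
  proof (cases "a = b")
    case False
    obtain a' where a': "transition n \<theta> a a'" "dominated n b a'"
      using exists_dominating_transition[OF less(2) assms(2) less(3) False assms(4,5)] by blast
    then have "composition n a'"
      by (auto simp: transition_def composition_move_grain)
    then have "(transition n \<theta>)\<^sup>*\<^sup>* a' b"
      using less(1) transition_sum_prefixes_less a' by blast
    with a' show ?thesis by (metis converse_rtranclp_into_rtranclp)
  qed simp
qed

section \<open>The SPM rule as \<open>T(2)\<close> on partitions\<close>

lemma transition_2_iff_spm_rule:
  assumes "int_partition n a"
  shows "transition n 2 a b \<longleftrightarrow> spm_rule n a b"
proof -
  have "a ! i \<ge> 1" if "int (a ! i) - int (a ! Suc i) \<ge> 2" for i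
    using that by linarith
  then show ?thesis
    using assms by (auto simp: transition_def spm_rule_def int_partition_def)
qed

lemma int_partition_nth_mono:
  assumes "int_partition n a" "i \<le> j" "j < n"
  shows "a ! j \<le> a ! i"
  using assms by (cases "i = j") (auto simp: int_partition_def composition_def sorted_wrt_iff_nth_less)

lemma spm_rule_int_partition:
  assumes "spm_rule n a b"
  shows "int_partition n b"
proof -
  obtain i where a: "int_partition n a" and i: "Suc i < n" "int (a ! i) - int (a ! Suc i) \<ge> 2"
    and b: "b = move_grain i a"
    using assms by (auto simp: spm_rule_def)
  have len: "length a = n" using a by (simp add: int_partition_def composition_def)
  have pos: "a ! i \<ge> 1" using i by linarith
  have "b ! k \<le> b ! j" if "j < k" "k < n" for j k
  proof -
    \<comment> \<open>The critical comparisons involve the lowered entry \<open>i\<close> or the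
      raised entry \<open>Suc i\<close>; the gap of 2 between them absorbs both changes.\<close>
    have "a ! k \<le> a ! j" "k > Suc i \<Longrightarrow> a ! k \<le> a ! Suc i" "j < i \<Longrightarrow> a ! i \<le> a ! j"
      using int_partition_nth_mono[OF a] that i by auto
    then show ?thesis using that i len by (auto simp: b nth_move_grain)
  qed
  then show ?thesis
    using composition_move_grain[of n a i] a b i pos len
    by (auto simp: int_partition_def sorted_wrt_iff_nth_less)
qed

lemma rtranclp_spm_rule_int_partition:
  assumes "(spm_rule n)\<^sup>*\<^sup>* a b" "int_partition n a"
  shows "int_partition n b"
  using assms by (induction rule: rtranclp_induct) (auto intro: spm_rule_int_partition)

lemma rtranclp_transition_2_iff_spm_rule:
  assumes "int_partition n a"
  shows "(transition n 2)\<^sup>*\<^sup>* a b \<longleftrightarrow> (spm_rule n)\<^sup>*\<^sup>* a b"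
proof
  assume "(transition n 2)\<^sup>*\<^sup>* a b"
  then show "(spm_rule n)\<^sup>*\<^sup>* a b"
  proof (induction rule: rtranclp_induct)
    case (step b c)
    then have "int_partition n b" using rtranclp_spm_rule_int_partition assms by blast
    then have "spm_rule n b c" using step transition_2_iff_spm_rule by blast
    with step show ?case by simp
  qed simp
next
  assume "(spm_rule n)\<^sup>*\<^sup>* a b"
  moreover have "spm_rule n \<le> transition n 2"
    using transition_2_iff_spm_rule by (auto simp: spm_rule_def)
  ultimately show "(transition n 2)\<^sup>*\<^sup>* a b" using rtranclp_mono by blast
qed

section \<open>The starting configuration and the slope invariant\<close>

lemma nth_start: "i < n \<Longrightarrow> start n ! i = (if i = 0 then n else 0)"
  by (auto simp: start_def nth_Cons split: nat.split)

lemma int_partition_start: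
  assumes "n \<ge> 1"
  shows "int_partition n (start n)"
proof -
  have "length (start n) = n" "sum_list (start n) = n"
    using assms by (auto simp: start_def sum_list_replicate)
  then show ?thesis
    by (auto simp: int_partition_def composition_def sorted_wrt_iff_nth_less nth_start)
qed

lemma dominated_start:
  assumes "n \<ge> 1" "composition n a"
  shows "dominated n a (start n)"
  unfolding dominated_def
proof
  fix i assume i: "i \<in> {1..n}"
  have "(\<Sum>j<i. a ! j) \<le> (\<Sum>j<n. a ! j)" using i by (intro sum_mono2) auto
  also have "\<dots> = n"
    using assms(2) sum_list_conv_prefix[of a] unfolding composition_def by metis
  also have "n = start n ! 0" using assms by (simp add: nth_start)
  also have "\<dots> \<le> (\<Sum>j<i. start n ! j)" using i by (intro member_le_sum) auto
  finally show "(\<Sum>j<i. a ! j) \<le> (\<Sum>j<i. start n ! j)" .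
qed

text \<open>This is the slope condition for \<open>\<theta> = 2\<close>, rearranged to avoid
  subtraction. Positivity of the later entry exempts trailing zeros.\<close>

lemma spm_rule_slope:
  assumes "spm_rule n a b"
    and slope: "\<And>i j. i < j \<Longrightarrow> j < n \<Longrightarrow> a ! j > 0 \<Longrightarrow> a ! j + j \<le> a ! i + i + 1"
    and ij: "i < j" "j < n" "b ! j > 0"
  shows "b ! j + j \<le> b ! i + i + 1"
proof -
  obtain k where a: "int_partition n a" and k: "Suc k < n" "a ! Suc k + 2 \<le> a ! k"
    and b: "b = move_grain k a"
    using assms(1) by (auto simp: spm_rule_def)
  have len: "length a = n" using a by (simp add: int_partition_def composition_def)
  note nth = nth_move_grain[of k a, unfolded len, OF k(1), folded b]
  consider "i = k" "j = Suc k" | "i = k" "j > Suc k" | "i < k" "j = Suc k"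
    | "i \<noteq> k" "j \<noteq> Suc k" using ij by linarith
  then show ?thesis
  proof cases
    case 1
    then show ?thesis using k by (simp add: nth)
  next
    case 2
    then show ?thesis using slope[of "Suc k" j] ij k by (simp add: nth)
  next
    \<comment> \<open>The bound is taken at \<open>k\<close>, since \<open>a ! Suc k\<close> may be
      0 while \<open>a ! k\<close> is positive; the gap of 2 carries it over to
      \<open>Suc k\<close>.\<close>
    case 3
    then show ?thesis using slope[of i k] k by (simp add: nth)
  next
    \<comment> \<open>Here entry \<open>i\<close> can only grow and entry \<open>j\<close> only
      shrink, which favours the bound.\<close>
    case 4
    then show ?thesis using slope[of i j] ij by (auto simp: nth split: if_splits)
  qed
qed

lemma SPM_set_slope:
  assumes "b \<in> SPM_set n" "i < j" "j < n" "b ! j > 0"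
  shows "b ! j + j \<le> b ! i + i + 1"
proof -
  have "(spm_rule n)\<^sup>*\<^sup>* (start n) b" using assms by (simp add: SPM_set_def)
  then show ?thesis using assms(2-4)
  proof (induction arbitrary: i j rule: rtranclp_induct)
    \<comment> \<open>Vacuous: the start has no positive entry after the first.\<close>
    case base
    then show ?case by (simp add: nth_start)
  next
    case (step b c)
    then show ?case using spm_rule_slope by blast
  qed
qed

lemma rtranclp_spm_rule_iff_dominated:
  assumes "int_partition n a" "b \<in> SPM_set n"
  shows "(spm_rule n)\<^sup>*\<^sup>* a b \<longleftrightarrow> dominated n b a"
proof
  assume "(spm_rule n)\<^sup>*\<^sup>* a b"
  then show "dominated n b a"
    using rtranclp_transition_2_iff_spm_rule rtranclp_transition_dominated assms(1) by blast
next
  assume dom: "dominated n b a"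
  have "composition n a" "composition n b"
    using assms by (auto simp: SPM_set_def int_partition_def)
  moreover have "int (b ! i) - int (b ! j) \<ge> (2 - 1) * (int j - int i) - 1"
    if "i < j" "j < n" "b ! j > 0" for i j
    using SPM_set_slope[OF assms(2) that] by simp
  ultimately have "(transition n 2)\<^sup>*\<^sup>* a b"
    using dom by (intro dominated_imp_rtranclp_transition) auto
  then show "(spm_rule n)\<^sup>*\<^sup>* a b"
    using rtranclp_transition_2_iff_spm_rule assms(1) by blast
qed

lemma rtranclp_transition_1_iff_dominated:
  assumes "composition n a" "int_partition n b"
  shows "(transition n 1)\<^sup>*\<^sup>* a b \<longleftrightarrow> dominated n b a"
proof
  assume dom: "dominated n b a"
  \<comment> \<open>For \<open>\<theta> = 1\<close> the linear term vanishes, and monotonicity of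
    \<open>b\<close> suffices.\<close>
  have "int (b ! i) - int (b ! j) \<ge> (1 - 1) * (int j - int i) - 1" if "i < j" "j < n" for i j
    using int_partition_nth_mono[OF assms(2), of i j] that by simp
  moreover have "composition n b" using assms(2) by (simp add: int_partition_def)
  ultimately show "(transition n 1)\<^sup>*\<^sup>* a b"
    using assms(1) dom by (intro dominated_imp_rtranclp_transition) auto
qed (rule rtranclp_transition_dominated)

section \<open>Comparison of the ordered sets\<close>

lemma L_2_eq_SPM:
  assumes "n \<ge> 1"
  shows "L n 2 = SPM n"
proof -
  note start = int_partition_start[OF assms]
  have set: "L_set n 2 = SPM_set n"
    using rtranclp_transition_2_iff_spm_rule[OF start] rtranclp_spm_rule_int_partition[OF _ start]
    by (auto simp: L_set_def SPM_set_def int_partition_def)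
  have "(transition n 2)\<^sup>*\<^sup>* a b \<longleftrightarrow> (spm_rule n)\<^sup>*\<^sup>* a b" if "a \<in> SPM_set n" for a b
    using that rtranclp_transition_2_iff_spm_rule by (simp add: SPM_set_def)
  with set show ?thesis by (auto simp: L_def SPM_def)
qed

lemma SPM_suborder_L_B: "SPM n \<unlhd> L_B n"
proof -
  have part: "int_partition n a" if "a \<in> SPM_set n" for a
    using that by (simp add: SPM_set_def)
  then show ?thesis
    using rtranclp_spm_rule_iff_dominated by (auto simp: suborder_def SPM_def L_B_def)
qed

lemma L_B_suborder_L_1:
  assumes "n \<ge> 1"
  shows "L_B n \<unlhd> L n 1"
proof -
  have comp: "composition n a" if "int_partition n a" for a
    using that by (simp add: int_partition_def)
  \<comment> \<open>The start dominates every composition, so each partition is reachable from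
    it.\<close>
  have "a \<in> L_set n 1" if "int_partition n a" for a
    using that rtranclp_transition_1_iff_dominated dominated_start[OF assms] comp
      int_partition_start[OF assms]
    by (simp add: L_set_def)
  then show ?thesis
    using rtranclp_transition_1_iff_dominated comp by (auto simp: suborder_def L_def L_B_def)
qed

theorem proposition3:
  fixes n :: nat
  assumes "n \<ge> 1"
  shows "L n 2 = SPM n \<and> SPM n \<unlhd> L_B n \<and> L_B n \<unlhd> L n 1"
  using L_2_eq_SPM[OF assms] SPM_suborder_L_B L_B_suborder_L_1[OF assms] by blast

end
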